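(* Let $\{\omega_n\}_{n=1}^\infty$ be a sequence of positive real numbers. If the Jacobi sequence $\{\omega_n\}_{n=1}^\infty$ has property (SC), then there exist two probability measures $\mu_{\mathrm{even}}$ and $\mu_{\mathrm{odd}}$ on $\mathbb{R}$ such that: (i) $\mu_{\mathrm{even}}$ and $\mu_{\mathrm{odd}}$ have finite moments of all orders, and the Jacobi sequence of each of them is $\{\omega_n\}_{n=1}^\infty$; (ii) both measures are symmetric under the reflection $\mathbb{R}\ni x\mapsto -x\in\mathbb{R}$; (iii) their Stieltjes transforms at $i$ are different, that is, $\displaystyle\int_{\mathbb{R}}\frac{1}{i-x}\,d\mu_{\mathrm{even}}(x)\neq\int_{\mathbb{R}}\frac{1}{i-x}\,d\mu_{\mathrm{odd}}(x)$.
   Context: A probability measure $\mu$ on $\mathbb{R}$ with infinite support and finite moments of all orders has Jacobi sequence $\{\omega_n\}_{n=1}^\infty$ if its monic orthogonal polynomials $P_0=1,P_1,\dots$ satisfy $xP_n(x)=P_{n+1}(x)+\omega_nP_{n-1}(x)$ for $n\ge0$, with $P_{-1}=0$. Property (SC): given $\{\omega_n\}_{n=1}^\infty$ with all $\omega_n>0$, define $B_{-1}=1$, $B_0=1$, $B_m=B_{m-1}+\omega_mB_{m-2}$ for $m\ge1$. The sequence has property (SC) if $\sum_{n=1}^\infty \frac{B_{n-1}}{B_n}<\infty$. (Equivalently, with $X_m$ the $(m+1)\times(m+1)$ symmetric tridiagonal matrix with zero diagonal and off-diagonal entries $\sqrt{\omega_1},\dots,\sqrt{\omega_m}$, and $G_m(i)$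 the upper-left entry of $(i-X_m)^{-1}$, the limits $\lim_m G_{2m}(i)$ and $\lim_m G_{2m+1}(i)$ are different.) *)

theory Defs
  imports "HOL-Probability.Probability" "HOL-Computational_Algebra.Polynomial"
begin

text \<open>A Jacobi sequence is a function \<open>\<omega> :: nat \<Rightarrow> real\<close> of which only the values at
  indices \<open>n \<ge> 1\<close> are used; \<open>\<omega> 0\<close> never enters any definition.\<close>

text \<open>The topological (closed) support.\<close>
definition measure_support :: "real measure \<Rightarrow> real set" where
  "measure_support \<mu> = {x. \<forall>U. open U \<longrightarrow> x \<in> U \<longrightarrow> emeasure \<mu> U > 0}"

definition finite_moments :: "real measure \<Rightarrow> bool" where
  "finite_moments \<mu> \<longleftrightarrow> (\<forall>k::nat. integrable \<mu> (\<lambda>x. x ^ k))"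

text \<open>For a measure with finite moments and infinite support, the following predicate determines
  \<open>P\<close> uniquely.\<close>
definition monic_orthogonal_polynomials :: "real measure \<Rightarrow> (nat \<Rightarrow> real poly) \<Rightarrow> bool" where
  "monic_orthogonal_polynomials \<mu> P \<longleftrightarrow>
     (\<forall>n. degree (P n) = n \<and> lead_coeff (P n) = 1) \<and>
     (\<forall>m n. m \<noteq> n \<longrightarrow> (\<integral>x. poly (P m) x * poly (P n) x \<partial>\<mu>) = 0)"

text \<open>The recurrence \<open>x P\<^sub>n = P\<^sub>n\<^sub>+\<^sub>1 + \<omega>\<^sub>n P\<^sub>n\<^sub>-\<^sub>1\<close> for \<open>n \<ge> 0\<close>; as \<open>P\<^sub>-\<^sub>1 = 0\<close>, its instance at
  \<open>n = 0\<close> reads \<open>x P\<^sub>0 = P\<^sub>1\<close>.\<close>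
definition has_Jacobi_sequence :: "real measure \<Rightarrow> (nat \<Rightarrow> real) \<Rightarrow> bool" where
  "has_Jacobi_sequence \<mu> \<omega> \<longleftrightarrow>
     real_distribution \<mu> \<and> infinite (measure_support \<mu>) \<and> finite_moments \<mu> \<and>
     (\<exists>P. monic_orthogonal_polynomials \<mu> P \<and>
          (\<forall>n. [:0, 1:] * P n =
               P (Suc n) + (if n = 0 then 0 else smult (\<omega> n) (P (n - 1)))))"

text \<open>\<open>SC_B \<omega> m\<close> is \<open>B\<^sub>m\<close> for \<open>m \<ge> 0\<close>. The value \<open>B\<^sub>-\<^sub>1 = 1\<close> is used only in
  \<open>B\<^sub>1 = B\<^sub>0 + \<omega>\<^sub>1 B\<^sub>-\<^sub>1 = 1 + \<omega>\<^sub>1\<close>.\<close>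
fun SC_B :: "(nat \<Rightarrow> real) \<Rightarrow> nat \<Rightarrow> real" where
  "SC_B \<omega> 0 = 1"
| "SC_B \<omega> (Suc 0) = SC_B \<omega> 0 + \<omega> 1 * 1"
| "SC_B \<omega> (Suc (Suc m)) = SC_B \<omega> (Suc m) + \<omega> (Suc (Suc m)) * SC_B \<omega> m"

text \<open>The series over \<open>n \<ge> 1\<close> of \<open>B\<^sub>n\<^sub>-\<^sub>1 / B\<^sub>n\<close>, re-indexed to start at 0. For a positive sequence
  \<open>\<omega>\<close> its terms are positive, so summability means that the sum is finite.\<close>
definition property_SC :: "(nat \<Rightarrow> real) \<Rightarrow> bool" where
  "property_SC \<omega> \<longleftrightarrow> summable (\<lambda>n. SC_B \<omega> n / SC_B \<omega> (Suc n))"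

definition reflection_symmetric :: "real measure \<Rightarrow> bool" where
  "reflection_symmetric \<mu> \<longleftrightarrow> distr \<mu> borel (\<lambda>x. - x) = \<mu>"

definition Stieltjes_transform :: "real measure \<Rightarrow> complex \<Rightarrow> complex" where
  "Stieltjes_transform \<mu> z = (\<integral>x. 1 / (z - complex_of_real x) \<partial>\<mu>)"

end

theory Submission
  imports Defs "HOL-Computational_Algebra.Fundamental_Theorem_Algebra"
begin

text \<open>
  The polynomials \<open>P\<^sub>n\<close> of the recurrence have \<open>n\<close> real simple zeros, and Gauss quadrature
  at the zeros of \<open>P\<^sub>n\<^sub>+\<^sub>1\<close> gives a symmetric probability measure with \<open>n + 1\<close> atoms, for
  which \<open>P\<^sub>0, \<dots>, P\<^sub>n\<close> are orthogonal with squared norms \<open>h\<^sub>k = \<omega>\<^sub>1 \<cdots> \<omega>\<^sub>k\<close>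
  (\<open>Gauss_quadrature_orthogonal\<close>).  It is the spectral measure of the truncated Jacobi matrix
  \<open>X\<^sub>n\<close> at the first basis vector.  Each moment of these Gauss measures is eventually constant in
  \<open>n\<close>, so they are tight, and along every weakly convergent subsequence the moments survive in
  the limit.  Every weak limit therefore is a symmetric measure with the Jacobi sequence \<open>\<omega>\<close>
  (\<open>weak_limit_Gauss_measure\<close>).

  Whether different subsequences can lead to different measures is decided at the point \<open>\<i>\<close>. There
  the Stieltjes transform of the Gauss measure is \<open>- \<i> g\<^sub>n\<close>, where
  \<open>g\<^sub>n = \<integral> 1 / (1 + x\<^sup>2)\<close> is the quotient of two solutions of the same scalar recurrence
  (\<open>Gauss_quadrature_at_i\<close>), that is, a convergent of a continued fraction whose denominators
  are the \<open>B\<^sub>n\<close>.  The Casorati determinant of the two solutions shows that consecutive convergents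
  differ by \<open>h\<^sub>n / (B\<^sub>n\<^sub>-\<^sub>1 B\<^sub>n)\<close> with alternating sign.  The quotient of consecutive such gaps
  is \<open>1 - B\<^sub>n\<^sub>-\<^sub>1 / B\<^sub>n\<close>, so property (SC) says exactly that the product of these quotients does not tend
  to \<open>0\<close>, and the gaps stay above a positive constant (\<open>gap_bounded_below\<close>).  A weak limit along even
  indices, and one along the successors of these indices, then have transforms at \<open>\<i>\<close>
  that differ by at least this constant.
\<close>

section \<open>Polynomials of a symmetric three-term recurrence\<close>

text \<open>
  The coefficients are taken in an arbitrary commutative ring so that the same
  recurrence can be evaluated at complex points; the zeros are first located there.
\<close>
fun jpoly :: "(nat \<Rightarrow> 'a::comm_ring_1) \<Rightarrow> nat \<Rightarrow> 'a poly" where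
  "jpoly \<omega> 0 = 1"
| "jpoly \<omega> (Suc 0) = [:0, 1:]"
| "jpoly \<omega> (Suc (Suc n)) = [:0, 1:] * jpoly \<omega> (Suc n) - smult (\<omega> (Suc n)) (jpoly \<omega> n)"

lemma degree_jpoly: "degree (jpoly \<omega> n :: 'a::idom poly) = n"
  and lead_coeff_jpoly: "lead_coeff (jpoly \<omega> n :: 'a::idom poly) = 1"
proof -
  have "degree (jpoly \<omega> n :: 'a poly) = n \<and> lead_coeff (jpoly \<omega> n) = 1"
  proof (induction \<omega> n rule: jpoly.induct)
    case (3 \<omega> n)
    have ne: "jpoly \<omega> (Suc n) \<noteq> 0" using 3 by auto
    have d: "degree ([:0, 1:] * jpoly \<omega> (Suc n)) = Suc (Suc n)"
      using 3 ne by (simp add: degree_mult_eq)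
    have l: "degree (smult (\<omega> (Suc n)) (jpoly \<omega> n)) < Suc (Suc n)"
      using degree_smult_le[of "\<omega> (Suc n)" "jpoly \<omega> n"] 3 by linarith
    have "degree (jpoly \<omega> (Suc (Suc n))) = Suc (Suc n)"
      using degree_add_eq_left[of "- smult (\<omega> (Suc n)) (jpoly \<omega> n)" "[:0, 1:] * jpoly \<omega> (Suc n)"] d l
      by simp
    moreover have "coeff (jpoly \<omega> (Suc n)) (Suc n) = 1" using 3 by metis
    hence "coeff (jpoly \<omega> (Suc (Suc n))) (Suc (Suc n)) = 1"
      using 3 by (simp add: coeff_eq_0)
    ultimately show ?case by simp
  qed auto
  thus "degree (jpoly \<omega> n :: 'a poly) = n" "lead_coeff (jpoly \<omega> n :: 'a poly) = 1" by auto
qed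

lemma coeff_jpoly_degree [simp]: "coeff (jpoly \<omega> n :: 'a::idom poly) n = 1"
  using lead_coeff_jpoly[of \<omega> n] by (simp only: degree_jpoly)

lemma jpoly_recurrence:
  "[:0, 1:] * jpoly \<omega> n = jpoly \<omega> (Suc n) + (if n = 0 then 0 else smult (\<omega> n) (jpoly \<omega> (n - 1)))"
  by (cases n) auto

lemma jpoly_reflect: "poly (jpoly \<omega> n) (- x) = (-1) ^ n * poly (jpoly \<omega> n) x"
  by (induction \<omega> n rule: jpoly.induct) (auto simp: algebra_simps)

lemma poly_jpoly_of_real:
  "poly (jpoly (\<lambda>k. of_real (\<omega> k)) n) (of_real x :: 'a::{real_algebra_1,comm_ring_1})
     = of_real (poly (jpoly \<omega> n) x)"
  by (induction \<omega> n rule: jpoly.induct) auto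

lemma poly_jpoly_cnj:
  "poly (jpoly (\<lambda>k. complex_of_real (\<omega> k)) n) (cnj z)
     = cnj (poly (jpoly (\<lambda>k. complex_of_real (\<omega> k)) n) z)"
  by (induction \<omega> n rule: jpoly.induct) auto

text \<open>The squared norm of the \<open>n\<close>-th monic orthogonal polynomial.\<close>
definition jnorm :: "(nat \<Rightarrow> 'a::comm_ring_1) \<Rightarrow> nat \<Rightarrow> 'a" where
  "jnorm \<omega> n = (\<Prod>k=1..n. \<omega> k)"

lemma jnorm_0 [simp]: "jnorm \<omega> 0 = 1"
  and jnorm_Suc [simp]: "jnorm \<omega> (Suc n) = \<omega> (Suc n) * jnorm \<omega> n"
  by (auto simp: jnorm_def mult.commute)

lemma jnorm_of_real: "jnorm (\<lambda>k. of_real (\<omega> k)) n = of_real (jnorm \<omega> n)"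
  by (induction n) auto

definition CD_kernel :: "(nat \<Rightarrow> 'a::field) \<Rightarrow> nat \<Rightarrow> 'a \<Rightarrow> 'a \<Rightarrow> 'a" where
  "CD_kernel \<omega> n x y = (\<Sum>k\<le>n. poly (jpoly \<omega> k) x * poly (jpoly \<omega> k) y / jnorm \<omega> k)"

text \<open>
  The increment of the right-hand side from \<open>n\<close> to \<open>n + 1\<close> is one application of the recurrence in
  each variable. This identity is used twice: with \<open>y\<close> the conjugate of a zero \<open>x\<close> it forces the
  zero to be real, and with two different zeros it makes them orthogonal in the
  dual sense that produces the quadrature weights.
\<close>
lemma Christoffel_Darboux:
  fixes \<omega> :: "nat \<Rightarrow> 'a::field"
  assumes "\<And>k. k \<ge> 1 \<Longrightarrow> \<omega> k \<noteq> 0"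
  shows "(x - y) * CD_kernel \<omega> n x y =
    (poly (jpoly \<omega> (Suc n)) x * poly (jpoly \<omega> n) y
      - poly (jpoly \<omega> n) x * poly (jpoly \<omega> (Suc n)) y) / jnorm \<omega> n"
proof (induction n)
  case 0
  show ?case by (simp add: CD_kernel_def)
next
  case (Suc n)
  have nz: "jnorm \<omega> n \<noteq> 0" "\<omega> (Suc n) \<noteq> 0"
    using assms by (auto simp: jnorm_def)
  have "(x - y) * CD_kernel \<omega> (Suc n) x y = (x - y) * CD_kernel \<omega> n x y
      + (x - y) * (poly (jpoly \<omega> (Suc n)) x * poly (jpoly \<omega> (Suc n)) y / jnorm \<omega> (Suc n))"
    by (simp add: CD_kernel_def algebra_simps)
  also have "\<dots> = (poly (jpoly \<omega> (Suc (Suc n))) x * poly (jpoly \<omega> (Suc n)) y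
      - poly (jpoly \<omega> (Suc n)) x * poly (jpoly \<omega> (Suc (Suc n))) y) / jnorm \<omega> (Suc n)"
    unfolding Suc.IH using nz by (simp add: field_simps)
  finally show ?case .
qed

section \<open>Weak limits of measures with convergent moments\<close>

text \<open>
  The point measure lives on the power set of \<open>R\<close>; its image under the inclusion is a Borel measure
  on the whole line.
\<close>
definition discrete_measure :: "real set \<Rightarrow> (real \<Rightarrow> real) \<Rightarrow> real measure" where
  "discrete_measure R w = distr (point_measure R (\<lambda>x. ennreal (w x))) borel (\<lambda>x. x)"

lemma real_distribution_discrete_measure:
  assumes "finite R" "\<And>x. x \<in> R \<Longrightarrow> w x \<ge> 0" "(\<Sum>x\<in>R. w x) = 1"
  shows "real_distribution (discrete_measure R w)"
proof -
  interpret prob_space "point_measure R (\<lambda>x. ennreal (w x))"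
  proof
    show "emeasure (point_measure R (\<lambda>x. ennreal (w x))) (space (point_measure R (\<lambda>x. ennreal (w x)))) = 1"
      using assms by (simp add: space_point_measure emeasure_point_measure_finite sum_ennreal)
  qed
  show ?thesis
    unfolding discrete_measure_def by (rule real_distribution_distr) simp
qed

lemma integrable_discrete_measure:
  fixes f :: "real \<Rightarrow> 'b::{banach, second_countable_topology}"
  assumes "finite R" "f \<in> borel_measurable borel"
  shows "integrable (discrete_measure R w) f"
  unfolding discrete_measure_def using assms
  by (subst integrable_distr_eq) (auto intro: integrable_point_measure_finite)

lemma integral_discrete_measure:
  fixes f :: "real \<Rightarrow> 'b::{banach, second_countable_topology}"
  assumes "finite R" "\<And>x. x \<in> R \<Longrightarrow> w x \<ge> 0" "f \<in> borel_measurable borel"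
  shows "(\<integral>x. f x \<partial>discrete_measure R w) = (\<Sum>x\<in>R. w x *\<^sub>R f x)"
  unfolding discrete_measure_def using assms
  by (subst integral_distr) (auto simp: lebesgue_integral_point_measure_finite)

text \<open>
  Symmetry is carried through characteristic functions: they determine the measure, and they
  converge pointwise under weak convergence.
\<close>
lemma char_even_discrete_measure:
  assumes "finite R" "\<And>x. x \<in> R \<Longrightarrow> w x \<ge> 0" "uminus ` R = R" "\<And>x. w (- x) = w x"
  shows "char (discrete_measure R w) (- t) = char (discrete_measure R w) t"
proof -
  have eq: "char (discrete_measure R w) t = (\<Sum>x\<in>R. w x *\<^sub>R iexp (t * x))" for t
    unfolding char_def using assms by (subst integral_discrete_measure) auto
  have "(\<Sum>x\<in>R. w x *\<^sub>R iexp (- t * x)) = (\<Sum>x\<in>uminus ` R. w x *\<^sub>R iexp (t * x))"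
    by (subst sum.reindex) (auto simp: assms)
  thus ?thesis unfolding eq assms(3) .
qed

lemma borel_measurable_poly [measurable]: "poly (p :: real poly) \<in> borel_measurable borel"
  by (intro borel_measurable_continuous_onI continuous_intros)

lemma finite_moments_integrable_poly:
  assumes "finite_moments M"
  shows "integrable M (poly p)"
  using assms unfolding finite_moments_def poly_altdef by auto

lemma finite_moments_integral_poly:
  assumes "finite_moments M"
  shows "(\<integral>x. poly p x \<partial>M) = (\<Sum>i\<le>degree p. coeff p i * (\<integral>x. x ^ i \<partial>M))"
  using assms unfolding finite_moments_def poly_altdef by simp

text \<open>
  Weak convergence only controls bounded functions. Truncating \<open>f\<close> at level \<open>C\<close> gives the bound \<open>m\<close>
  for each truncation, and monotone convergence lets \<open>C\<close> tend to infinity.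
\<close>
lemma weak_limit_integral_nonneg:
  fixes M :: "nat \<Rightarrow> real measure" and f :: "real \<Rightarrow> real"
  assumes M: "\<And>n. real_distribution (M n)" and L: "real_distribution L" and conv: "weak_conv_m M L"
    and int: "\<And>n. integrable (M n) f" and lim: "(\<lambda>n. \<integral>x. f x \<partial>M n) \<longlonglongrightarrow> m"
    and f: "\<And>x. f x \<ge> 0" "\<And>x. isCont f x"
  shows "integrable L f" and "(\<integral>x. f x \<partial>L) \<le> m"
proof -
  interpret L: real_distribution L by fact
  have [measurable]: "f \<in> borel_measurable borel"
    using f(2) by (intro borel_measurable_continuous_onI continuous_at_imp_continuous_on) auto
  let ?g = "\<lambda>C::nat. \<lambda>x. min (f x) (real C)"
  have le: "(\<integral>x. ?g C x \<partial>L) \<le> m" for C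
  proof (rule LIMSEQ_le)
    show "(\<lambda>n. \<integral>x. ?g C x \<partial>M n) \<longlonglongrightarrow> (\<integral>x. ?g C x \<partial>L)"
      using f by (intro weak_conv_imp_integral_bdd_continuous_conv[OF M L conv, where B = "real C"])
        (auto intro!: continuous_intros)
    show "(\<lambda>n. \<integral>x. f x \<partial>M n) \<longlonglongrightarrow> m" by fact
    have "(\<integral>x. ?g C x \<partial>M n) \<le> (\<integral>x. f x \<partial>M n)" for n
    proof -
      interpret Mn: real_distribution "M n" by fact
      have "integrable (M n) (?g C)"
        using f by (intro Mn.integrable_const_bound[where B = "real C"]) auto
      thus ?thesis using int by (intro integral_mono) auto
    qed
    thus "\<exists>N. \<forall>n\<ge>N. (\<integral>x. ?g C x \<partial>M n) \<le> (\<integral>x. f x \<partial>M n)" by blast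
  qed
  have ig: "integrable L (?g C)" for C
    using f by (intro L.integrable_const_bound[where B = "real C"]) auto
  have inc: "incseq (\<lambda>C. \<integral>x. ?g C x \<partial>L)"
    by (intro incseq_SucI integral_mono ig) auto
  obtain l where l: "(\<lambda>C. \<integral>x. ?g C x \<partial>L) \<longlonglongrightarrow> l"
    using incseq_convergent[OF inc, of m] le by blast
  have pw: "(\<lambda>C. ?g C x) \<longlonglongrightarrow> f x" for x
  proof (rule tendsto_eventually)
    show "eventually (\<lambda>C. ?g C x = f x) sequentially"
      using eventually_ge_at_top[of "nat \<lceil>f x\<rceil>"] by eventually_elim linarith
  qed
  have mono: "mono (\<lambda>C. ?g C x)" for x by (auto simp: mono_def)
  show "integrable L f"
    by (rule integrable_monotone_convergence[where f = ?g, OF ig _ _ l]) (use mono pw in auto)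
  have "(\<integral>x. f x \<partial>L) = l"
    by (rule integral_monotone_convergence[where f = ?g, OF ig _ _ l]) (use mono pw in auto)
  thus "(\<integral>x. f x \<partial>L) \<le> m" using LIMSEQ_le_const2[OF l] le by auto
qed

text \<open>
  No mass of \<open>x ^ k\<close> escapes to infinity, because the moment of order \<open>2 k\<close> is under control
  as well: cutting \<open>x ^ k\<close> off at height \<open>C\<close> costs at most \<open>x ^ (2 * k) / C\<close>, uniformly along the
  sequence and in the limit.
\<close>
lemma weak_limit_moments:
  fixes M :: "nat \<Rightarrow> real measure"
  assumes M: "\<And>n. real_distribution (M n)" and L: "real_distribution L" and conv: "weak_conv_m M L"
    and fm: "\<And>n. finite_moments (M n)" and lim: "\<And>k. (\<lambda>n. \<integral>x. x ^ k \<partial>M n) \<longlonglongrightarrow> m k"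
  shows "finite_moments L" and "(\<integral>x. x ^ k \<partial>L) = m k"
proof -
  interpret L: real_distribution L by fact
  have even: "integrable L (\<lambda>x. x ^ (2 * k))" "(\<integral>x. x ^ (2 * k) \<partial>L) \<le> m (2 * k)" for k
    using fm lim by (intro weak_limit_integral_nonneg[OF M L conv]; auto simp: finite_moments_def)+
  have int: "integrable L (\<lambda>x. x ^ k)" for k
  proof (rule Bochner_Integration.integrable_bound)
    show "integrable L (\<lambda>x. 1 + x ^ (2 * k))" using even(1)[of k] by simp
    have "\<bar>x ^ k\<bar> \<le> 1 + x ^ (2 * k)" for x :: real
    proof -
      have "0 \<le> (\<bar>x ^ k\<bar> - 1 / 2)\<^sup>2" by simp
      also have "\<dots> = (x ^ k)\<^sup>2 - \<bar>x ^ k\<bar> + 1 / 4"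
        by (simp add: power2_diff power2_abs) (simp add: power2_eq_square)
      finally show ?thesis unfolding power_even_eq by linarith
    qed
    thus "AE x in L. norm (x ^ k) \<le> norm (1 + x ^ (2 * k))"
      using order.trans[OF _ abs_ge_self] by (intro AE_I2) (simp only: real_norm_def, blast)
  qed simp
  thus "finite_moments L" by (simp add: finite_moments_def)
  have bound: "\<bar>(\<integral>x. x ^ k \<partial>L) - m k\<bar> \<le> 2 * m (2 * k) / C" if C: "C > 0" for C :: real
  proof -
    let ?g = "\<lambda>x::real. max (- C) (min C (x ^ k))"
    have tail: "\<bar>(\<integral>x. x ^ k \<partial>N) - (\<integral>x. ?g x \<partial>N)\<bar> \<le> (\<integral>x. x ^ (2 * k) \<partial>N) / C"
      if N: "real_distribution N" "finite_moments N" for N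
    proof -
      interpret N: real_distribution N by fact
      have i1: "integrable N (\<lambda>x. x ^ k)" "integrable N (\<lambda>x. x ^ (2 * k))"
        using N by (auto simp: finite_moments_def)
      have i2: "integrable N ?g"
        using C by (intro N.integrable_const_bound[where B = C]) auto
      have "\<bar>(\<integral>x. x ^ k \<partial>N) - (\<integral>x. ?g x \<partial>N)\<bar> = \<bar>\<integral>x. x ^ k - ?g x \<partial>N\<bar>"
        using i1 i2 by simp
      also have "\<dots> \<le> (\<integral>x. \<bar>x ^ k - ?g x\<bar> \<partial>N)"
        by (rule integral_abs_bound)
      also have "\<dots> \<le> (\<integral>x. x ^ (2 * k) / C \<partial>N)"
      proof (rule integral_mono)
        fix x :: real
        show "\<bar>x ^ k - ?g x\<bar> \<le> x ^ (2 * k) / C"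
        proof (cases "\<bar>x ^ k\<bar> \<le> C")
          case True
          hence "x ^ k - ?g x = 0" by auto
          moreover have "x ^ (2 * k) / C \<ge> 0" using C by simp
          ultimately show ?thesis by simp
        next
          case False
          have "\<bar>y - max (- C) (min C y)\<bar> \<le> \<bar>y\<bar>" for y
            using C by (auto simp: abs_if max_def min_def)
          hence "\<bar>x ^ k - ?g x\<bar> \<le> \<bar>x ^ k\<bar>" .
          also have "\<dots> \<le> \<bar>x ^ k\<bar> * \<bar>x ^ k\<bar> / C"
            unfolding pos_le_divide_eq[OF C] using False by (intro mult_left_mono) auto
          also have "\<bar>x ^ k\<bar> * \<bar>x ^ k\<bar> = x ^ (2 * k)"
            by (simp flip: power2_eq_square power_mult add: mult.commute)
          finally show ?thesis .
        qed
      qed (use i1 i2 in auto)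
      finally show ?thesis by simp
    qed
    have "(\<lambda>n. \<integral>x. ?g x \<partial>M n) \<longlonglongrightarrow> (\<integral>x. ?g x \<partial>L)"
      using C by (intro weak_conv_imp_integral_bdd_continuous_conv[OF M L conv, where B = C])
        (auto intro!: continuous_intros)
    hence "(\<lambda>n. \<bar>(\<integral>x. x ^ k \<partial>M n) - (\<integral>x. ?g x \<partial>M n)\<bar>) \<longlonglongrightarrow> \<bar>m k - (\<integral>x. ?g x \<partial>L)\<bar>"
      by (intro tendsto_intros lim)
    moreover have "(\<lambda>n. (\<integral>x. x ^ (2 * k) \<partial>M n) / C) \<longlonglongrightarrow> m (2 * k) / C"
      using C by (intro tendsto_intros lim) auto
    ultimately have "\<bar>m k - (\<integral>x. ?g x \<partial>L)\<bar> \<le> m (2 * k) / C"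
      by (rule LIMSEQ_le) (use tail M fm in blast)
    moreover have "\<bar>(\<integral>x. x ^ k \<partial>L) - (\<integral>x. ?g x \<partial>L)\<bar> \<le> m (2 * k) / C"
      using tail[OF L \<open>finite_moments L\<close>] even(2)[of k] C
      by (meson divide_right_mono less_imp_le order.trans)
    ultimately show ?thesis by (simp add: field_simps)
  qed
  have "(\<lambda>n. 2 * m (2 * k) / real (Suc n)) \<longlonglongrightarrow> 0"
    using LIMSEQ_Suc[OF lim_const_over_n[of "2 * m (2 * k)"]] .
  hence "\<bar>(\<integral>x. x ^ k \<partial>L) - m k\<bar> \<le> 0"
    by (rule LIMSEQ_le_const) (use bound in auto)
  thus "(\<integral>x. x ^ k \<partial>L) = m k" by simp
qed

text \<open>Markov's inequality for \<open>x\<^sup>2\<close>.\<close>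
lemma tight_if_second_moments_bounded:
  fixes M :: "nat \<Rightarrow> real measure"
  assumes M: "\<And>n. real_distribution (M n)" and int: "\<And>n. integrable (M n) (\<lambda>x. x ^ 2)"
    and bd: "\<And>n. (\<integral>x. x ^ 2 \<partial>M n) \<le> C"
  shows "tight M"
  unfolding tight_def
proof (intro conjI allI impI M)
  fix \<epsilon> :: real assume \<epsilon>: "\<epsilon> > 0"
  \<comment> \<open>the summand 1 makes \<open>a\<close> positive and the resulting bound strict\<close>
  define a where "a = sqrt (\<bar>C\<bar> / \<epsilon>) + 1"
  have a1: "a > 0" unfolding a_def by (smt (verit) \<epsilon> divide_nonneg_pos real_sqrt_ge_zero)
  have "\<bar>C\<bar> / \<epsilon> < a\<^sup>2"
  proof -
    have "\<bar>C\<bar> / \<epsilon> = (sqrt (\<bar>C\<bar> / \<epsilon>))\<^sup>2" using \<epsilon> by simp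
    also have "\<dots> < a\<^sup>2" unfolding a_def using \<epsilon> by (intro power_strict_mono) auto
    finally show ?thesis .
  qed
  hence a2: "C / a\<^sup>2 < \<epsilon>"
    using \<epsilon> a1 by (simp add: field_simps)
  show "\<exists>a b. a < b \<and> (\<forall>n. 1 - \<epsilon> < measure (M n) {a<..b})"
  proof (intro exI conjI allI)
    show "- a < a" using a1 by simp
    fix n
    interpret Mn: real_distribution "M n" by fact
    have "measure (M n) {x \<in> space (M n). x ^ 2 \<ge> a\<^sup>2} \<le> (\<integral>x. x ^ 2 \<partial>M n) / a\<^sup>2"
      using a1 int by (intro integral_Markov_inequality_measure[where A = "{}"]) auto
    also have "\<dots> \<le> C / a\<^sup>2" using bd a1 by (simp add: divide_right_mono)
    also have "\<dots> < \<epsilon>" by fact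
    finally have 1: "measure (M n) {x. x ^ 2 \<ge> a\<^sup>2} < \<epsilon>" by simp
    have "1 - measure (M n) {x. x ^ 2 \<ge> a\<^sup>2} = measure (M n) (UNIV - {x. x ^ 2 \<ge> a\<^sup>2})"
      using Mn.prob_compl[of "{x. x ^ 2 \<ge> a\<^sup>2}"] by simp
    also have "\<dots> \<le> measure (M n) {- a<..a}"
    proof (rule Mn.finite_measure_mono)
      show "UNIV - {x. x ^ 2 \<ge> a\<^sup>2} \<subseteq> {- a<..a}"
      proof
        fix x assume "x \<in> UNIV - {x. x ^ 2 \<ge> a\<^sup>2}"
        hence "\<bar>x\<bar> < a" using a1 by (metis (no_types, lifting) Diff_iff abs_le_square_iff abs_of_pos mem_Collect_eq not_le)
        thus "x \<in> {- a<..a}" by auto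
      qed
    qed simp
    finally show "1 - \<epsilon> < measure (M n) {- a<..a}" using 1 by linarith
  qed
qed

lemma weak_limit_reflection_symmetric:
  fixes M :: "nat \<Rightarrow> real measure"
  assumes M: "\<And>n. real_distribution (M n)" and L: "real_distribution L" and conv: "weak_conv_m M L"
    and char: "\<And>n t. char (M n) (- t) = char (M n) t"
  shows "reflection_symmetric L"
proof -
  interpret L: real_distribution L by fact
  have "char (distr L borel uminus) t = char L t" for t
  proof -
    have "char (distr L borel uminus) t = char L (- t)"
      unfolding char_def by (subst integral_distr) auto
    also have "\<dots> = char L t"
      using levy_continuity1[OF M L conv, of t] levy_continuity1[OF M L conv, of "- t"]
      unfolding char by (rule LIMSEQ_unique[rotated])
    finally show ?thesis .
  qed
  moreover have "real_distribution (distr L borel uminus)" by (rule L.real_distribution_distr) simp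
  ultimately show ?thesis
    unfolding reflection_symmetric_def by (intro Levy_uniqueness[OF _ L]) auto
qed

text \<open>
  The complement of the support is a union of open null sets, possibly uncountable; by the
  Lindelof property countably many of them suffice.
\<close>
lemma AE_in_measure_support:
  assumes "real_distribution M"
  shows "AE x in M. x \<in> measure_support M"
proof -
  interpret real_distribution M by fact
  let ?F = "{U. open U \<and> emeasure M U = 0}"
  obtain F where F: "F \<subseteq> ?F" "countable F" "\<Union>F = \<Union>?F"
    using Lindelof[of ?F] by auto
  have "(\<Union>U\<in>F. U) \<in> null_sets M"
    using F by (intro null_sets_UN') (auto simp: null_sets_def)
  hence "AE x in M. x \<notin> \<Union>?F" using F(3) AE_not_in by force
  moreover have "\<Union>?F = - measure_support M"
    by (auto simp: measure_support_def zero_less_iff_neq_zero)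
  ultimately show ?thesis by simp
qed

lemma Im_Stieltjes_transform_i:
  assumes "real_distribution M"
  shows "Im (Stieltjes_transform M \<i>) = - (\<integral>x. 1 / (1 + x\<^sup>2) \<partial>M)"
proof -
  interpret real_distribution M by fact
  have "cmod (1 / (\<i> - complex_of_real x)) \<le> 1" for x
  proof -
    have "1 \<le> cmod (\<i> - complex_of_real x)"
      using abs_Im_le_cmod[of "\<i> - complex_of_real x"] by simp
    thus ?thesis by (simp add: norm_divide divide_le_eq_1)
  qed
  hence "integrable M (\<lambda>x. 1 / (\<i> - complex_of_real x))"
    by (intro integrable_const_bound[where B = 1]) auto
  hence "Im (Stieltjes_transform M \<i>) = (\<integral>x. Im (1 / (\<i> - complex_of_real x)) \<partial>M)"
    unfolding Stieltjes_transform_def by simp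
  also have "(\<lambda>x. Im (1 / (\<i> - complex_of_real x))) = (\<lambda>x. - (1 / (1 + x\<^sup>2)))"
    by (auto simp: Im_divide power2_eq_square add.commute)
  finally show ?thesis by simp
qed

section \<open>Real simple zeros and Gauss quadrature\<close>

locale positive_Jacobi =
  fixes \<omega> :: "nat \<Rightarrow> real"
  assumes pos: "\<And>n. n \<ge> 1 \<Longrightarrow> \<omega> n > 0"
begin

abbreviation P :: "nat \<Rightarrow> real poly" where "P \<equiv> jpoly \<omega>"
abbreviation h :: "nat \<Rightarrow> real" where "h \<equiv> jnorm \<omega>"
abbreviation PC :: "nat \<Rightarrow> complex poly" where "PC \<equiv> jpoly (\<lambda>k. complex_of_real (\<omega> k))"

lemma \<omega>_neq_0: "k \<ge> 1 \<Longrightarrow> \<omega> k \<noteq> 0"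
  using pos[of k] by auto

lemma h_pos: "h n > 0"
  unfolding jnorm_def using pos by (auto intro: prod_pos)

text \<open>The term of index \<open>0\<close> alone is \<open>1\<close>.\<close>
lemma CD_kernel_diag_pos: "CD_kernel \<omega> n x x > 0"
proof -
  have "CD_kernel \<omega> n x x \<ge> (\<Sum>k\<in>{0}. poly (P k) x * poly (P k) x / h k)"
    unfolding CD_kernel_def using h_pos by (intro sum_mono2) (auto simp: less_imp_le)
  thus ?thesis by simp
qed

text \<open>
  For a zero \<open>z\<close> the Christoffel-Darboux identity at \<open>z\<close> and its conjugate has right-hand side \<open>0\<close>,
  since the conjugate is also a zero, while the kernel is a sum of nonnegative terms, the first being
  \<open>1\<close>. Hence \<open>z\<close> equals its conjugate.
\<close>
lemma PC_roots_real:
  assumes "poly (PC (Suc n)) z = 0"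
  shows "z \<in> \<real>"
proof -
  let ?\<omega> = "\<lambda>k. complex_of_real (\<omega> k)"
  let ?S = "\<Sum>k\<le>n. (cmod (poly (PC k) z))\<^sup>2 / h k"
  have "CD_kernel ?\<omega> n z (cnj z) = of_real ?S"
    by (simp add: CD_kernel_def poly_jpoly_cnj jnorm_of_real complex_norm_square[symmetric])
  moreover have "(z - cnj z) * CD_kernel ?\<omega> n z (cnj z) = 0"
    using assms \<omega>_neq_0 by (subst Christoffel_Darboux) (auto simp: poly_jpoly_cnj)
  moreover have "?S \<ge> (\<Sum>k\<in>{0}. (cmod (poly (PC k) z))\<^sup>2 / h k)"
    using h_pos by (intro sum_mono2) (auto simp: less_imp_le)
  hence "complex_of_real ?S \<noteq> 0" by (simp del: of_real_sum)
  ultimately have "z - cnj z = 0" by (simp only: mult_eq_0_iff) blast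
  hence "cnj z = z" by simp
  thus ?thesis by (metis Reals_cnj_iff)
qed

text \<open>
  By the recurrence the Wronskian of index \<open>n + 1\<close> is \<open>P\<^sub>n\<^sub>+\<^sub>1\<^sup>2 + \<omega>\<^sub>n\<^sub>+\<^sub>1\<close> times that of index
  \<open>n\<close>. Positivity excludes a common zero of a polynomial and its derivative.
\<close>
lemma PC_Wronskian_pos:
  "\<exists>r>0. poly (pderiv (PC (Suc n))) (of_real x) * poly (PC n) (of_real x)
      - poly (PC (Suc n)) (of_real x) * poly (pderiv (PC n)) (of_real x) = of_real r"
proof (induction n)
  case 0
  show ?case by (auto intro!: exI[of _ "1::real"] simp: pderiv_pCons)
next
  case (Suc n)
  then obtain r where r: "r > 0"
    "poly (pderiv (PC (Suc n))) (of_real x) * poly (PC n) (of_real x)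
      - poly (PC (Suc n)) (of_real x) * poly (pderiv (PC n)) (of_real x) = of_real r" by blast
  let ?s = "(poly (P (Suc n)) x)\<^sup>2 + \<omega> (Suc n) * r"
  have "?s > 0" using r pos[of "Suc n"] by (simp add: add_nonneg_pos)
  moreover
  have "poly (pderiv (PC (Suc (Suc n)))) (of_real x) * poly (PC (Suc n)) (of_real x)
      - poly (PC (Suc (Suc n))) (of_real x) * poly (pderiv (PC (Suc n))) (of_real x)
     = (poly (PC (Suc n)) (of_real x))\<^sup>2 + of_real (\<omega> (Suc n)) *
      (poly (pderiv (PC (Suc n))) (of_real x) * poly (PC n) (of_real x)
      - poly (PC (Suc n)) (of_real x) * poly (pderiv (PC n)) (of_real x))"
    unfolding jpoly.simps(3) pderiv_diff pderiv_mult pderiv_smult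
    by (simp add: pderiv_pCons algebra_simps power2_eq_square)
  hence "poly (pderiv (PC (Suc (Suc n)))) (of_real x) * poly (PC (Suc n)) (of_real x)
      - poly (PC (Suc (Suc n))) (of_real x) * poly (pderiv (PC (Suc n))) (of_real x)
     = (poly (PC (Suc n)) (of_real x))\<^sup>2 + of_real (\<omega> (Suc n)) * of_real r"
    unfolding r(2) .
  hence "poly (pderiv (PC (Suc (Suc n)))) (of_real x) * poly (PC (Suc n)) (of_real x)
      - poly (PC (Suc (Suc n))) (of_real x) * poly (pderiv (PC (Suc n))) (of_real x) = of_real ?s"
    unfolding poly_jpoly_of_real[of \<omega> "Suc n" x] of_real_add of_real_mult of_real_power .
  ultimately show ?case by blast
qed

definition nodes :: "nat \<Rightarrow> real set" where
  "nodes n = {x. poly (P (Suc n)) x = 0}"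

lemma jpoly_neq_0: "P n \<noteq> 0"
  using lead_coeff_jpoly[of \<omega> n] by auto

lemma finite_nodes: "finite (nodes n)"
  unfolding nodes_def by (rule poly_roots_finite) (rule jpoly_neq_0)

text \<open>
  Over the complex numbers a polynomial without double zeros has as many zeros as its degree, and
  all of them were shown to be real.
\<close>
lemma card_nodes: "card (nodes n) = Suc n"
proof -
  let ?p = "PC (Suc n)"
  have real: "\<exists>x. z = of_real x" if "poly ?p z = 0" for z
    using PC_roots_real[OF that] by (auto elim: Reals_cases)
  have "rsquarefree ?p"
    unfolding rsquarefree_roots
  proof (intro allI notI)
    fix z assume z: "poly ?p z = 0 \<and> poly (pderiv ?p) z = 0"
    then obtain x where "z = of_real x" using real by blast
    with z PC_Wronskian_pos[of n x] show False by auto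
  qed
  from arg_cong[OF complex_poly_decompose_rsquarefree[OF this], of degree]
  have "card {z. poly ?p z = 0} = degree ?p"
    by (simp add: lead_coeff_jpoly degree_prod_sum_eq)
  hence "card {z. poly ?p z = 0} = Suc n" by (simp add: degree_jpoly)
  moreover have "{z. poly ?p z = 0} = complex_of_real ` nodes n"
    using real by (fastforce simp: nodes_def poly_jpoly_of_real)
  ultimately show ?thesis
    by (simp add: card_image inj_on_def)
qed

text \<open>The Christoffel numbers of Gauss quadrature.\<close>
definition weight :: "nat \<Rightarrow> real \<Rightarrow> real" where
  "weight n x = 1 / CD_kernel \<omega> n x x"

lemma weight_pos: "weight n x > 0"
  unfolding weight_def using CD_kernel_diag_pos by simp

lemma nodes_uminus: "uminus ` nodes n = nodes n"
proof -
  have "- x \<in> nodes n \<longleftrightarrow> x \<in> nodes n" for x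
    by (simp add: nodes_def jpoly_reflect del: jpoly.simps)
  thus ?thesis by (auto intro: image_eqI[of _ _ "- _"])
qed

lemma weight_uminus: "weight n (- x) = weight n x"
proof -
  have "(-1) ^ k * (-1) ^ k = (1::real)" for k :: nat
    by (simp flip: power_add mult_2)
  hence "poly (P k) (- x) * poly (P k) (- x) = poly (P k) x * poly (P k) x" for k
    by (simp add: jpoly_reflect algebra_simps)
  thus ?thesis by (simp add: weight_def CD_kernel_def)
qed

lemma CD_kernel_nodes:
  assumes "x \<in> nodes n" "y \<in> nodes n" "x \<noteq> y"
  shows "CD_kernel \<omega> n x y = 0"
proof -
  have "(x - y) * CD_kernel \<omega> n x y = 0"
    using assms \<omega>_neq_0 by (subst Christoffel_Darboux) (auto simp: nodes_def)
  thus ?thesis using assms by simp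
qed

lemma jpoly_linear_independent:
  fixes c :: "nat \<Rightarrow> real"
  assumes "(\<Sum>k\<le>n. smult (c k) (P k)) = 0" "k \<le> n"
  shows "c k = 0"
  using assms
proof (induction n arbitrary: k)
  case 0
  thus ?case by simp
next
  case (Suc n)
  have "coeff (\<Sum>k\<le>n. smult (c k) (P k)) (Suc n) = 0"
    unfolding coeff_sum by (intro sum.neutral) (auto simp: coeff_eq_0 degree_jpoly)
  hence "coeff (\<Sum>k\<le>Suc n. smult (c k) (P k)) (Suc n) = c (Suc n)"
    by (simp del: jpoly.simps)
  with Suc.prems have c0: "c (Suc n) = 0" by (simp del: jpoly.simps)
  with Suc show ?case by (cases "k = Suc n") (auto simp del: jpoly.simps)
qed

text \<open>
  The matrix of the values \<open>P\<^sub>k x\<close>, suitably scaled, has orthonormal columns because the kernel is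
  diagonal on the nodes; being square, it has orthonormal rows. The proof expresses
  this by interpolation: the quadrature expansion of \<open>P\<^sub>l\<close> in the basis \<open>P\<^sub>0, \<dots>, P\<^sub>n\<close> agrees with
  \<open>P\<^sub>l\<close> at all \<open>n + 1\<close> nodes, hence equals it, and the coefficients can be compared.
\<close>
lemma Gauss_quadrature_orthogonal:
  assumes "k \<le> n" "l \<le> n"
  shows "(\<Sum>x\<in>nodes n. weight n x * (poly (P k) x * poly (P l) x)) = (if k = l then h k else 0)"
proof -
  define d where "d j = (\<Sum>x\<in>nodes n. weight n x * (poly (P j) x * poly (P l) x)) / h j" for j
  let ?g = "\<Sum>j\<le>n. smult (d j) (P j)"
  have eq: "poly ?g y = poly (P l) y" if "y \<in> nodes n" for y
  proof -
    have "poly ?g y = (\<Sum>j\<le>n. d j * poly (P j) y)"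
      by (simp add: poly_sum)
    also have "\<dots> = (\<Sum>j\<le>n. \<Sum>x\<in>nodes n. weight n x * poly (P l) x * (poly (P j) x * poly (P j) y / h j))"
      unfolding d_def by (simp add: sum_distrib_left sum_distrib_right sum_divide_distrib mult_ac)
    also have "\<dots> = (\<Sum>x\<in>nodes n. weight n x * poly (P l) x * CD_kernel \<omega> n x y)"
      unfolding CD_kernel_def by (subst sum.swap) (simp add: sum_distrib_left)
    also have "\<dots> = (\<Sum>x\<in>nodes n. if x = y then poly (P l) y else 0)"
      using CD_kernel_diag_pos[of n y] that
      by (intro sum.cong) (auto simp: CD_kernel_nodes weight_def)
    also have "\<dots> = poly (P l) y" using that by (simp add: finite_nodes)
    finally show ?thesis .
  qed
  have "degree ?g \<le> n"
    by (intro degree_sum_le) (auto simp: degree_jpoly intro: order.trans[OF degree_smult_le])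
  hence "?g = P l"
    using eq assms by (intro poly_eqI_degree[of "nodes n"]) (auto simp: card_nodes degree_jpoly)
  hence "(\<Sum>j\<le>n. smult (d j - (if j = l then 1 else 0)) (P j)) = 0"
    using assms by (simp add: smult_diff_left sum_subtractf if_distrib[of "\<lambda>c. smult c _"] cong: if_cong)
  from jpoly_linear_independent[OF this \<open>k \<le> n\<close>] have "d k = (if k = l then 1 else 0)" by simp
  thus ?thesis using h_pos[of k] by (auto simp: d_def field_simps split: if_splits)
qed

lemma jpoly_expansion:
  assumes "degree q \<le> n"
  obtains c where "q = (\<Sum>k\<le>n. smult (c k) (P k))"
proof -
  have "\<exists>c. q = (\<Sum>k\<le>n. smult (c k) (P k))"
    using assms
  proof (induction n arbitrary: q)
    case 0
    then obtain a where "q = [:a:]" by (auto elim: degree_eq_zeroE)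
    thus ?case by (auto intro!: exI[of _ "\<lambda>_. a"])
  next
    case (Suc n)
    define a where "a = coeff q (Suc n)"
    have "degree (q - smult a (P (Suc n))) \<le> n"
    proof (rule degree_le, intro allI impI)
      fix i assume "n < i"
      thus "coeff (q - smult a (P (Suc n))) i = 0"
        using Suc.prems by (cases "i = Suc n") (auto simp: a_def coeff_eq_0 degree_jpoly simp del: jpoly.simps)
    qed
    from Suc.IH[OF this] obtain c where c: "q - smult a (P (Suc n)) = (\<Sum>k\<le>n. smult (c k) (P k))" by blast
    have "(\<Sum>k\<le>n. smult ((c(Suc n := a)) k) (P k)) = (\<Sum>k\<le>n. smult (c k) (P k))"
      by (intro sum.cong) auto
    hence "q = (\<Sum>k\<le>Suc n. smult ((c(Suc n := a)) k) (P k))"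
      using c by (simp del: jpoly.simps add: algebra_simps)
    thus ?case by blast
  qed
  thus ?thesis using that by blast
qed

section \<open>Values at the imaginary unit and property (SC)\<close>

text \<open>
  Denominators and numerators of the continued fraction: two solutions of one scalar recurrence.
  The shift by one against \<open>B\<close> makes \<open>den n\<close> the modulus of \<open>P\<^sub>n\<close> at \<open>\<i>\<close>.
\<close>
fun den :: "nat \<Rightarrow> real" where
  "den 0 = 1" | "den (Suc n) = SC_B \<omega> n"

fun num :: "nat \<Rightarrow> real" where
  "num 0 = 0" | "num (Suc 0) = 1" | "num (Suc (Suc n)) = num (Suc n) + \<omega> (Suc n) * num n"

lemma den_rec: "den (Suc (Suc n)) = den (Suc n) + \<omega> (Suc n) * den n"
  by (cases n) auto

lemma den_pos: "den n > 0"
proof -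
  have "den n > 0 \<and> den (Suc n) > 0"
    by (induction n) (auto simp: den_rec pos add_pos_pos simp del: den.simps(2), simp)
  thus ?thesis by simp
qed

lemma PC_at_i: "poly (PC n) \<i> = \<i> ^ n * of_real (den n)"
proof (induction n rule: induct_nat_012)
  case (ge2 n)
  have "poly (PC (Suc (Suc n))) \<i> = \<i> * poly (PC (Suc n)) \<i> - of_real (\<omega> (Suc n)) * poly (PC n) \<i>"
    by simp
  thus ?case unfolding ge2 den_rec by (simp add: algebra_simps)
qed auto

text \<open>
  The sum is the value at \<open>\<i>\<close> of the polynomial of the second kind belonging to \<open>P\<^sub>k\<close>. It satisfies
  the recurrence of the \<open>P\<^sub>k\<close>, because the extra term is the quadrature of \<open>P\<^sub>k\<close>, which vanishes for
  \<open>1 \<le> k \<le> n\<close>. That is just enough to reach \<open>k = n + 1\<close>.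
\<close>
lemma Gauss_quadrature_second_kind:
  assumes "k \<le> Suc n"
  shows "\<i> * (\<Sum>x\<in>nodes n. of_real (weight n x) *
      ((poly (PC k) \<i> - of_real (poly (P k) x)) / (\<i> - of_real x))) = \<i> ^ k * of_real (num k)"
  using assms
proof (induction k rule: induct_nat_012)
  case 0
  show ?case by simp
next
  case 1
  have ix: "\<i> - of_real x \<noteq> 0" for x :: real by (auto simp: complex_eq_iff)
  have "(\<Sum>x\<in>nodes n. weight n x) = 1"
    using Gauss_quadrature_orthogonal[of 0 n 0] by simp
  thus ?case using ix by (simp flip: of_real_sum)
next
  case (ge2 k)
  let ?S = "\<lambda>k. \<Sum>x\<in>nodes n. of_real (weight n x) *
      ((poly (PC k) \<i> - of_real (poly (P k) x)) / (\<i> - of_real x))"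
  have ix: "\<i> - of_real x \<noteq> 0" for x :: real by (auto simp: complex_eq_iff)
  have "(\<Sum>x\<in>nodes n. weight n x * poly (P (Suc k)) x) = 0"
    using Gauss_quadrature_orthogonal[of "Suc k" n 0] ge2.prems by (simp del: jpoly.simps(3) jpoly.simps(2))
  hence z: "(\<Sum>x\<in>nodes n. complex_of_real (weight n x) * of_real (poly (P (Suc k)) x)) = 0"
    by (simp flip: of_real_sum of_real_mult)
  have "of_real w * ((poly (PC (Suc (Suc k))) \<i> - of_real (poly (P (Suc (Suc k))) x)) / (\<i> - of_real x))
      = \<i> * (of_real w * ((poly (PC (Suc k)) \<i> - of_real (poly (P (Suc k)) x)) / (\<i> - of_real x)))
       + of_real w * of_real (poly (P (Suc k)) x)
       - of_real (\<omega> (Suc k)) * (of_real w * ((poly (PC k) \<i> - of_real (poly (P k) x)) / (\<i> - of_real x)))"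
    for x w :: real
    using ix[of x] unfolding jpoly.simps(3) by (simp add: divide_simps) (simp add: algebra_simps)
  hence "?S (Suc (Suc k)) = \<i> * ?S (Suc k)
      + (\<Sum>x\<in>nodes n. of_real (weight n x) * of_real (poly (P (Suc k)) x))
      - of_real (\<omega> (Suc k)) * ?S k"
    by (simp only: sum.distrib sum_subtractf sum_distrib_left)
  hence step: "?S (Suc (Suc k)) = \<i> * ?S (Suc k) + 0 - of_real (\<omega> (Suc k)) * ?S k"
    unfolding z .
  have "\<i> * A = \<i> * (\<i> * B) - w * (\<i> * C)" if "A = \<i> * B + 0 - w * C" for A B C w
    unfolding that by (simp add: algebra_simps)
  from this[OF step]
  have "\<i> * ?S (Suc (Suc k)) = \<i> * (\<i> * ?S (Suc k)) - of_real (\<omega> (Suc k)) * (\<i> * ?S k)" .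
  also have "\<i> * ?S (Suc k) = \<i> ^ Suc k * of_real (num (Suc k))" using ge2 by simp
  also have "\<i> * ?S k = \<i> ^ k * of_real (num k)" using ge2 by simp
  finally show ?case by (simp add: algebra_simps)
qed

text \<open>
  At \<open>k = n + 1\<close> the term \<open>P\<^sub>k x\<close> vanishes on the nodes, so the polynomial of the second kind factors
  as \<open>P\<^sub>n\<^sub>+\<^sub>1\<close> times the Stieltjes transform, both at \<open>\<i>\<close>. The claim is the imaginary part of this.
\<close>
lemma Gauss_quadrature_at_i:
  "(\<Sum>x\<in>nodes n. weight n x / (1 + x\<^sup>2)) = num (Suc n) / den (Suc n)"
proof -
  let ?S = "\<Sum>x\<in>nodes n. of_real (weight n x) / (\<i> - of_real x)"
  have "\<i> * (\<Sum>x\<in>nodes n. of_real (weight n x) *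
      ((poly (PC (Suc n)) \<i> - of_real (poly (P (Suc n)) x)) / (\<i> - of_real x)))
     = \<i> * poly (PC (Suc n)) \<i> * ?S"
    by (simp add: nodes_def sum_distrib_left mult_ac del: jpoly.simps)
  with Gauss_quadrature_second_kind[of "Suc n" n]
  have "\<i> * (\<i> ^ Suc n * of_real (den (Suc n))) * ?S = \<i> ^ Suc n * of_real (num (Suc n))"
    by (simp only: PC_at_i order.refl)
  hence "\<i> ^ Suc n * (\<i> * of_real (den (Suc n)) * ?S) = \<i> ^ Suc n * of_real (num (Suc n))"
    by (simp only: mult_ac)
  hence "\<i> * of_real (den (Suc n)) * ?S = of_real (num (Suc n))"
    by (subst (asm) mult_left_cancel) simp_all
  moreover have "Im (of_real w / (\<i> - of_real x)) = - w / (1 + x\<^sup>2)" for w x :: real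
    by (simp add: Im_divide power2_eq_square add.commute)
  hence "Im ?S = - (\<Sum>x\<in>nodes n. weight n x / (1 + x\<^sup>2))"
    by (simp add: sum_negf)
  moreover have "Re (\<i> * of_real (den (Suc n)) * ?S) = - den (Suc n) * Im ?S"
    by (simp del: den.simps)
  ultimately have "den (Suc n) * (\<Sum>x\<in>nodes n. weight n x / (1 + x\<^sup>2)) = num (Suc n)"
    by simp
  thus ?thesis using den_pos[of "Suc n"] by (simp add: field_simps del: den.simps num.simps)
qed

text \<open>The distance of two consecutive convergents of the continued fraction.\<close>
definition gap :: "nat \<Rightarrow> real" where
  "gap n = h n / (den n * den (Suc n))"

lemma Casorati: "num (Suc n) * den n - num n * den (Suc n) = (-1) ^ n * h n"
proof (induction n)
  case (Suc n)
  have "num (Suc (Suc n)) * den (Suc n) - num (Suc n) * den (Suc (Suc n))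
     = - \<omega> (Suc n) * (num (Suc n) * den n - num n * den (Suc n))"
    unfolding den_rec num.simps by (simp add: algebra_simps del: den.simps)
  thus ?case unfolding Suc by simp
qed simp

lemma convergent_difference:
  "num (Suc n) / den (Suc n) - num n / den n = (-1) ^ n * gap n"
proof -
  have "num (Suc n) / den (Suc n) - num n / den n
     = (num (Suc n) * den n - num n * den (Suc n)) / (den n * den (Suc n))"
    using den_pos[of n] den_pos[of "Suc n"] by (simp add: field_simps del: den.simps num.simps)
  thus ?thesis unfolding Casorati by (simp add: gap_def)
qed

lemma gap_pos: "gap n > 0"
  using h_pos den_pos by (simp add: gap_def del: den.simps)

lemma gap_Suc: "gap (Suc n) = gap n * (1 - SC_B \<omega> n / SC_B \<omega> (Suc n))"
proof -
  have eq: "1 - SC_B \<omega> n / SC_B \<omega> (Suc n) = \<omega> (Suc n) * den n / den (Suc (Suc n))"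
    using den_pos[of "Suc (Suc n)"] den_rec[of n] by (simp add: field_simps)
  show ?thesis
    unfolding eq gap_def jnorm_Suc
    using den_pos[of n] den_pos[of "Suc n"] den_pos[of "Suc (Suc n)"]
    by (simp add: field_simps del: den.simps SC_B.simps)
qed

text \<open>
  Once the tail of the series is below \<open>1 / 2\<close>, the inequality \<open>(1 - s) (1 - t) \<ge> 1 - s - t\<close>
  shows that the gaps lose at most half of their size from then on.
\<close>
lemma gap_bounded_below:
  assumes "property_SC \<omega>"
  obtains c where "c > 0" "\<And>n. gap n \<ge> c"
proof -
  define t where "t n = SC_B \<omega> n / SC_B \<omega> (Suc n)" for n
  have gS: "gap (Suc n) = gap n * (1 - t n)" for n using gap_Suc by (simp add: t_def)
  have t0: "t n > 0" for n
    using den_pos[of "Suc n"] den_pos[of "Suc (Suc n)"] by (simp add: t_def)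
  have t1: "t n < 1" for n
    using gap_pos[of n] gap_pos[of "Suc n"] unfolding gS by (simp add: zero_less_mult_iff)
  have sm: "summable t" using assms by (simp add: property_SC_def t_def[abs_def])
  obtain N where N: "norm (\<Sum>i. t (i + N)) < 1/2"
    using suminf_exist_split[OF _ sm, of "1/2"] by auto
  have tail: "(\<Sum>i<m. t (i + N)) \<le> 1/2" for m
  proof -
    have "(\<Sum>i<m. t (i + N)) \<le> (\<Sum>i. t (i + N))"
      using sm t0 by (intro sum_le_suminf) (auto simp: less_imp_le summable_iff_shift)
    thus ?thesis using N by simp
  qed
  have low: "gap (m + N) \<ge> gap N * (1 - (\<Sum>i<m. t (i + N)))" for m
  proof (induction m)
    case (Suc m)
    let ?s = "\<Sum>i<m. t (i + N)"
    have "?s \<ge> 0" using t0 by (intro sum_nonneg) (simp add: less_imp_le)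
    hence "1 - (?s + t (m + N)) \<le> (1 - ?s) * (1 - t (m + N))"
      using t0[of "m + N"] by (simp add: algebra_simps)
    hence "gap N * (1 - (?s + t (m + N))) \<le> gap N * (1 - ?s) * (1 - t (m + N))"
      using gap_pos[of N] by (simp add: mult.assoc)
    also have "\<dots> \<le> gap (m + N) * (1 - t (m + N))"
      using Suc t1[of "m + N"] by (intro mult_right_mono) auto
    finally show ?case by (simp add: gS)
  qed simp
  have "decseq gap"
    unfolding decseq_Suc_iff gS using gap_pos t0 by (auto simp: less_imp_le)
  define c where "c = gap N / 2"
  have "gap n \<ge> c" for n
  proof (cases "n \<ge> N")
    case True
    then obtain m where m: "n = m + N" by (metis add.commute le_Suc_ex)
    have "gap N * (1/2) \<le> gap N * (1 - (\<Sum>i<m. t (i + N)))"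
      using tail[of m] gap_pos[of N] by (intro mult_left_mono) auto
    thus ?thesis using low[of m] by (simp add: m c_def)
  next
    case False
    hence "gap N \<le> gap n" using \<open>decseq gap\<close> by (simp add: decseq_def)
    thus ?thesis using gap_pos[of N] by (simp add: c_def)
  qed
  moreover have "c > 0" using gap_pos[of N] by (simp add: c_def)
  ultimately show ?thesis using that by blast
qed

section \<open>Gauss measures and their weak limits\<close>

definition Gauss_measure :: "nat \<Rightarrow> real measure" where
  "Gauss_measure n = discrete_measure (nodes n) (weight n)"

lemma real_distribution_Gauss_measure: "real_distribution (Gauss_measure n)"
  unfolding Gauss_measure_def
  using Gauss_quadrature_orthogonal[of 0 n 0] finite_nodes weight_pos
  by (intro real_distribution_discrete_measure) (auto simp: less_imp_le)

lemma finite_moments_Gauss_measure: "finite_moments (Gauss_measure n)"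
  unfolding Gauss_measure_def finite_moments_def
  by (auto intro: integrable_discrete_measure finite_nodes)

lemma integral_Gauss_measure:
  fixes f :: "real \<Rightarrow> real"
  assumes "f \<in> borel_measurable borel"
  shows "(\<integral>x. f x \<partial>Gauss_measure n) = (\<Sum>x\<in>nodes n. weight n x * f x)"
  unfolding Gauss_measure_def using assms weight_pos finite_nodes
  by (subst integral_discrete_measure) (auto simp: less_imp_le)

lemma char_Gauss_measure_even: "char (Gauss_measure n) (- t) = char (Gauss_measure n) t"
  unfolding Gauss_measure_def
  by (rule char_even_discrete_measure)
     (auto simp: finite_nodes weight_pos less_imp_le nodes_uminus weight_uminus)

lemma integral_jpoly_Gauss_measure:
  assumes "k \<le> n" "l \<le> n"
  shows "(\<integral>x. poly (P k) x * poly (P l) x \<partial>Gauss_measure n) = (if k = l then h k else 0)"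
  using Gauss_quadrature_orthogonal[OF assms] by (subst integral_Gauss_measure) auto

text \<open>
  Once \<open>n\<close> is at least the degree of \<open>q\<close>, only the coefficient of \<open>P\<^sub>0\<close> in the expansion of \<open>q\<close>
  contributes, and that does not depend on \<open>n\<close>.
\<close>
lemma poly_integral_stable:
  obtains c where "\<And>n. n \<ge> degree q \<Longrightarrow> (\<integral>x. poly q x \<partial>Gauss_measure n) = c"
proof -
  obtain c where c: "q = (\<Sum>k\<le>degree q. smult (c k) (P k))"
    using jpoly_expansion[of q "degree q"] by auto
  have q: "poly q x = (\<Sum>k\<le>degree q. c k * poly (P k) x)" for x
    using arg_cong[OF c, of "\<lambda>p. poly p x"] unfolding poly_sum poly_smult .
  have "(\<integral>x. poly q x \<partial>Gauss_measure n) = c 0" if "n \<ge> degree q" for n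
  proof -
    have "(\<integral>x. poly q x \<partial>Gauss_measure n)
        = (\<integral>x. (\<Sum>k\<le>degree q. c k * poly (P k) x) \<partial>Gauss_measure n)"
      by (simp only: q)
    also have "\<dots> = (\<Sum>k\<le>degree q. c k * (\<integral>x. poly (P k) x \<partial>Gauss_measure n))"
      using finite_moments_integrable_poly[OF finite_moments_Gauss_measure] by simp
    also have "\<dots> = (\<Sum>k\<le>degree q. if k = 0 then c 0 else 0)"
    proof (rule sum.cong)
      fix k assume "k \<in> {..degree q}"
      with integral_jpoly_Gauss_measure[of k n 0] that
      show "c k * (\<integral>x. poly (P k) x \<partial>Gauss_measure n) = (if k = 0 then c 0 else 0)"
        by auto
    qed simp
    finally show ?thesis by simp
  qed
  thus ?thesis using that by blast
qed

text \<open>The common moments of all measures obtained as weak limits below.\<close>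
definition moment :: "nat \<Rightarrow> real" where
  "moment k = lim (\<lambda>n. \<integral>x. x ^ k \<partial>Gauss_measure n)"

lemma moment_tendsto: "(\<lambda>n. \<integral>x. x ^ k \<partial>Gauss_measure n) \<longlonglongrightarrow> moment k"
proof -
  obtain c where c: "\<And>n. n \<ge> k \<Longrightarrow> (\<integral>x. x ^ k \<partial>Gauss_measure n) = c"
    using poly_integral_stable[of "monom 1 k"] by (auto simp: poly_monom degree_monom_eq)
  hence "(\<lambda>n. \<integral>x. x ^ k \<partial>Gauss_measure n) \<longlonglongrightarrow> c"
    by (intro tendsto_eventually eventually_sequentiallyI[of k]) auto
  thus ?thesis unfolding moment_def by (simp add: limI)
qed

lemma tight_Gauss_measure: "tight Gauss_measure"
proof -
  have "Bseq (\<lambda>n. \<integral>x. x ^ 2 \<partial>Gauss_measure n)"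
    using moment_tendsto[of 2] convergentI convergent_imp_Bseq by blast
  then obtain C where "\<And>n. \<bar>\<integral>x. x ^ 2 \<partial>Gauss_measure n\<bar> \<le> C"
    by (auto simp: Bseq_def)
  thus ?thesis
    using finite_moments_Gauss_measure
    by (intro tight_if_second_moments_bounded[where C = C] real_distribution_Gauss_measure)
       (auto simp: finite_moments_def abs_le_iff)
qed

text \<open>
  On a finite support the monic polynomial \<open>f\<close> with exactly these zeros is \<open>0\<close> almost everywhere, yet
  its inner product with \<open>P\<^sub>N\<close> for \<open>N = degree f\<close> is \<open>h\<^sub>N > 0\<close>.
\<close>
lemma infinite_support_if_orthogonal:
  assumes M: "real_distribution M" "finite_moments M"
    and orth: "\<And>k l. (\<integral>x. poly (P k) x * poly (P l) x \<partial>M) = (if k = l then h k else 0)"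
  shows "infinite (measure_support M)"
proof
  let ?S = "measure_support M"
  assume fin: "finite ?S"
  define f where "f = (\<Prod>s\<in>?S. [:- s, 1:])"
  define N where "N = degree f"
  have monic: "lead_coeff f = 1" by (simp add: f_def lead_coeff_prod)
  obtain c where c: "f = (\<Sum>k\<le>N. smult (c k) (P k))"
    using jpoly_expansion[of f N] by (auto simp: N_def)
  have "coeff f N = (\<Sum>k\<le>N. c k * coeff (P k) N)"
    by (subst c) (simp add: coeff_sum)
  also have "\<dots> = (\<Sum>k\<le>N. if k = N then c N else 0)"
    by (intro sum.cong) (auto simp: coeff_eq_0 degree_jpoly)
  finally have cN: "c N = 1" using monic by (simp add: N_def)
  have "(\<integral>x. poly f x * poly (P N) x \<partial>M) = (\<integral>x. 0 \<partial>M)"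
  proof (rule integral_cong_AE)
    show "AE x in M. poly f x * poly (P N) x = 0"
      using AE_in_measure_support[OF M(1)]
      by eventually_elim (auto simp: f_def poly_prod fin)
    interpret real_distribution M by fact
    show "(\<lambda>x. poly f x * poly (P N) x) \<in> borel_measurable M"
      by measurable
  qed simp
  moreover have "(\<integral>x. poly f x * poly (P N) x \<partial>M)
      = (\<integral>x. (\<Sum>k\<le>N. c k * (poly (P k) x * poly (P N) x)) \<partial>M)"
    by (subst c) (simp add: poly_sum sum_distrib_right mult.assoc)
  moreover have "\<dots> = (\<Sum>k\<le>N. c k * (\<integral>x. poly (P k) x * poly (P N) x \<partial>M))"
  proof -
    have "poly (P k * P N) = (\<lambda>x. poly (P k) x * poly (P N) x)" for k by auto
    hence "integrable M (\<lambda>x. poly (P k) x * poly (P N) x)" for k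
      using finite_moments_integrable_poly[OF M(2)] by metis
    thus ?thesis by simp
  qed
  moreover have "\<dots> = h N" using cN by (simp add: orth if_distrib[of "\<lambda>y. c _ * y"] cong: if_cong)
  ultimately show False using h_pos[of N] by simp
qed

text \<open>
  Orthogonality passes to the limit because it is a statement about moments, which are
  eventually constant along the Gauss measures; symmetry and the value at \<open>\<i>\<close> pass because they
  concern bounded continuous functions.
\<close>
lemma weak_limit_Gauss_measure:
  assumes r: "strict_mono r" and L: "real_distribution L" and conv: "weak_conv_m (Gauss_measure \<circ> r) L"
  shows "finite_moments L" and "has_Jacobi_sequence L \<omega>" and "reflection_symmetric L"
    and "(\<lambda>n. num (Suc (r n)) / den (Suc (r n))) \<longlonglongrightarrow> (\<integral>x. 1 / (1 + x\<^sup>2) \<partial>L)"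
proof -
  have M: "real_distribution ((Gauss_measure \<circ> r) n)" for n
    by (simp add: real_distribution_Gauss_measure)
  have fM: "finite_moments ((Gauss_measure \<circ> r) n)" for n
    by (simp add: finite_moments_Gauss_measure)
  have lim: "(\<lambda>n. \<integral>x. x ^ k \<partial>(Gauss_measure \<circ> r) n) \<longlonglongrightarrow> moment k" for k
    using LIMSEQ_subseq_LIMSEQ[OF moment_tendsto r] by (simp add: o_def)
  show fin: "finite_moments L" by (rule weak_limit_moments[OF M L conv fM lim])
  have mom: "(\<integral>x. x ^ k \<partial>L) = moment k" for k by (rule weak_limit_moments[OF M L conv fM lim])
  show "reflection_symmetric L"
    by (rule weak_limit_reflection_symmetric[OF M L conv]) (simp add: char_Gauss_measure_even)
  have orth: "(\<integral>x. poly (P k) x * poly (P l) x \<partial>L) = (if k = l then h k else 0)" for k l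
  proof -
    have "(\<lambda>n. \<integral>x. poly (P k * P l) x \<partial>Gauss_measure n) \<longlonglongrightarrow> (\<integral>x. poly (P k * P l) x \<partial>L)"
      unfolding finite_moments_integral_poly[OF finite_moments_Gauss_measure]
        finite_moments_integral_poly[OF fin] mom
      by (intro tendsto_intros moment_tendsto)
    moreover have "(\<lambda>n. \<integral>x. poly (P k * P l) x \<partial>Gauss_measure n) \<longlonglongrightarrow> (if k = l then h k else 0)"
      by (intro tendsto_eventually eventually_sequentiallyI[of "max k l"])
         (simp add: integral_jpoly_Gauss_measure)
    ultimately show ?thesis by (simp add: LIMSEQ_unique)
  qed
  show "has_Jacobi_sequence L \<omega>"
    unfolding has_Jacobi_sequence_def monic_orthogonal_polynomials_def
    using L fin infinite_support_if_orthogonal[OF L fin orth]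
    by (intro conjI exI[of _ P] allI jpoly_recurrence degree_jpoly lead_coeff_jpoly) (auto simp: orth)
  have "(\<lambda>n. \<integral>x. 1 / (1 + x\<^sup>2) \<partial>(Gauss_measure \<circ> r) n) \<longlonglongrightarrow> (\<integral>x. 1 / (1 + x\<^sup>2) \<partial>L)"
  proof (rule weak_conv_imp_integral_bdd_continuous_conv[OF M L conv, where B = 1])
    have nz: "1 + x\<^sup>2 > (0::real)" for x by (smt (verit) zero_le_power2)
    show "isCont (\<lambda>x. 1 / (1 + x\<^sup>2)) x" for x :: real
      using nz[of x] by (intro continuous_intros) auto
    show "norm (1 / (1 + x\<^sup>2)) \<le> 1" for x :: real using nz[of x] by (simp add: field_simps)
  qed
  thus "(\<lambda>n. num (Suc (r n)) / den (Suc (r n))) \<longlonglongrightarrow> (\<integral>x. 1 / (1 + x\<^sup>2) \<partial>L)"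
    by (simp add: integral_Gauss_measure Gauss_quadrature_at_i del: num.simps den.simps)
qed

end

theorem theorem3p12:
  fixes \<omega> :: "nat \<Rightarrow> real"
  assumes "\<And>n. n \<ge> 1 \<Longrightarrow> \<omega> n > 0"
    and "property_SC \<omega>"
  shows "\<exists>\<mu>_even \<mu>_odd :: real measure.
    real_distribution \<mu>_even \<and> real_distribution \<mu>_odd \<and>
    finite_moments \<mu>_even \<and> finite_moments \<mu>_odd \<and>
    has_Jacobi_sequence \<mu>_even \<omega> \<and> has_Jacobi_sequence \<mu>_odd \<omega> \<and>
    reflection_symmetric \<mu>_even \<and> reflection_symmetric \<mu>_odd \<and>
    Stieltjes_transform \<mu>_even \<i> \<noteq> Stieltjes_transform \<mu>_odd \<i>"
proof -
  interpret positive_Jacobi \<omega> by standard (fact assms(1))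
  have sm2: "strict_mono (\<lambda>k::nat. 2 * k)" by (simp add: strict_mono_def)
  obtain r L\<^sub>e where r: "strict_mono r" "real_distribution L\<^sub>e"
      "weak_conv_m (Gauss_measure \<circ> (\<lambda>k. 2 * k) \<circ> r) L\<^sub>e"
    using tight_imp_convergent_subsubsequence[OF tight_Gauss_measure sm2] by blast
  have sm_odd: "strict_mono (\<lambda>k. Suc (2 * r k))" using r(1) by (simp add: strict_mono_def)
  \<comment> \<open>a further subsequence of the same indices, so that both limits are approached simultaneously\<close>
  obtain s L\<^sub>o where s: "strict_mono s" "real_distribution L\<^sub>o"
      "weak_conv_m (Gauss_measure \<circ> (\<lambda>k. Suc (2 * r k)) \<circ> s) L\<^sub>o"
    using tight_imp_convergent_subsubsequence[OF tight_Gauss_measure sm_odd] by blast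
  have even: "strict_mono (\<lambda>k. 2 * r k)" "weak_conv_m (Gauss_measure \<circ> (\<lambda>k. 2 * r k)) L\<^sub>e"
    using r by (auto simp: strict_mono_def o_def)
  have odd: "strict_mono (\<lambda>k. Suc (2 * r (s k)))"
      "weak_conv_m (Gauss_measure \<circ> (\<lambda>k. Suc (2 * r (s k)))) L\<^sub>o"
    using r s by (auto simp: strict_mono_def o_def)
  note Le = weak_limit_Gauss_measure[OF even(1) r(2) even(2)]
  note Lo = weak_limit_Gauss_measure[OF odd(1) s(2) odd(2)]
  let ?g = "\<lambda>n. num (Suc n) / den (Suc n)"
  obtain c where c: "c > 0" "\<And>n. gap n \<ge> c" using gap_bounded_below[OF assms(2)] by blast
  have "(\<lambda>k. ?g (2 * r (s k))) \<longlonglongrightarrow> (\<integral>x. 1 / (1 + x\<^sup>2) \<partial>L\<^sub>e)"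
    using LIMSEQ_subseq_LIMSEQ[OF Le(4) s(1)] by (simp only: o_def)
  from tendsto_diff[OF this Lo(4)]
  have "(\<integral>x. 1 / (1 + x\<^sup>2) \<partial>L\<^sub>e) - (\<integral>x. 1 / (1 + x\<^sup>2) \<partial>L\<^sub>o) \<ge> c"
  proof (rule LIMSEQ_le_const, intro exI allI impI)
    fix k :: nat
    have "?g (Suc (2 * r (s k))) - ?g (2 * r (s k)) = - gap (Suc (2 * r (s k)))"
      by (subst convergent_difference) simp
    thus "c \<le> ?g (2 * r (s k)) - ?g (Suc (2 * r (s k)))"
      using c(2)[of "Suc (2 * r (s k))"] by linarith
  qed
  hence "Im (Stieltjes_transform L\<^sub>e \<i>) \<noteq> Im (Stieltjes_transform L\<^sub>o \<i>)"
    using c(1) by (simp add: Im_Stieltjes_transform_i r s)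
  hence "Stieltjes_transform L\<^sub>e \<i> \<noteq> Stieltjes_transform L\<^sub>o \<i>" by auto
  with r s Le Lo show ?thesis by blast
qed

end
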